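(* Let $k$ be a field and let $H$ be the Hopf algebra whose underlying algebra is the polynomial ring $k[X,Y,Z]$, with coproduct $$\triangle(X)=1\otimes X+X\otimes1+Y\otimes Z,\quad \triangle(Y)=1\otimes Y+Y\otimes1,\quad\triangle(Z)=1\otimes Z+Z\otimes1.$$ Let $C$ be the rack bialgebra with basis $1,x,y,z,t$ described in the context. Then $C$ becomes a Yetter-Drinfel'd rack over $H$ with the map $q\colon C\to H$ given by $q(1)=1$, $q(x)=X$, $q(y)=Y$, $q(z)=Z$, $q(t)=0$.
   Context: Sweedler notation $\triangle(c)=c_{(1)}\otimes c_{(2)}$ is used. A rack bialgebra is a coassociative counital coalgebra $(C,\triangle,\epsilon)$ with a distinguished group-like element $1\in C$ together with a morphism of coalgebras $\lhd\colon C\otimes C\to C$ such that for all $a,b,c\in C$: $(a\lhd b)\lhd c=(a\lhd c_{(1)})\lhd(b\lhd c_{(2)})$, $a\lhd 1=a$, $1\lhd a=\epsilon(a)1$, $\epsilon(a\lhd b)=\epsilon(a)\epsilon(b)$. The rack bialgebra $C$ of the claim has vector space basis $1,x,y,z,t$; $1$ is group-like (and is the coaugmentation), $t,y,z$ are primitive, $\triangle(x)=1\otimes x+x\otimes1+y\otimes z$, and $\epsilon(1)=1$, $\epsilon(x)=\epsilon(y)=\epsilon(z)=\epsilon(t)=0$. The rack product is determined by $a\lhd1=a$ and $1\lhd a=\epsilon(a)1$ for all $a\in C$, $-\lhd x=0$, $-\lhd t=0$, $x\lhd z=x\lhd y=t$, and $z\lhd z=z\lhd y=y\lhd z=y\lhd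 y=t\lhd z=t\lhd y=0$. Let $H$ be a bialgebra. A Yetter-Drinfel'd rack over $H$ is a rack bialgebra $C$ together with a right $H$-module structure $\cdot\colon C\otimes H\to C$ making $C$ an $H$-module coalgebra (i.e. the action is a morphism of counital coalgebras), and a morphism $q\colon C\to H$ of counital coaugmented coalgebras (so $q(1)=1_H$), such that $a\lhd b=a\cdot q(b)$ and $h_{(1)}\,q(a\cdot h_{(2)})=q(a)\,h$ for all $h\in H$, $a,b\in C$. *)

theory Defs
  imports Complex_Main "HOL-Library.Poly_Mapping" "HOL-Library.Product_Plus"
begin

section \<open>Based vector spaces and their tensor products\<close>

text \<open>
  A vector space over a field \<open>'k\<close> with basis \<open>'b\<close> is the type \<open>'b \<Rightarrow>\<^sub>0 'k\<close> of finitely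
  supported functions. Every vector space has this form up to isomorphism. The tensor product of
  \<open>'b \<Rightarrow>\<^sub>0 'k\<close> and \<open>'c \<Rightarrow>\<^sub>0 'k\<close> is \<open>'b \<times> 'c \<Rightarrow>\<^sub>0 'k\<close>; its universal property is proved
  below (\<open>tensor_universal\<close>).
\<close>

definition scale :: "'k::field \<Rightarrow> ('b \<Rightarrow>\<^sub>0 'k) \<Rightarrow> ('b \<Rightarrow>\<^sub>0 'k)" where
  "scale c v = Poly_Mapping.map ((*) c) v"

definition basis :: "'b \<Rightarrow> ('b \<Rightarrow>\<^sub>0 'k::field)" where
  "basis b = Poly_Mapping.single b 1"

abbreviation lin :: "(('b \<Rightarrow>\<^sub>0 'k::field) \<Rightarrow> ('c \<Rightarrow>\<^sub>0 'k)) \<Rightarrow> bool" where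
  "lin \<equiv> Vector_Spaces.linear scale scale"

abbreviation lin_form :: "(('b \<Rightarrow>\<^sub>0 'k::field) \<Rightarrow> 'k) \<Rightarrow> bool" where
  "lin_form \<equiv> Vector_Spaces.linear scale (*)"

definition bilin ::
  "(('b \<Rightarrow>\<^sub>0 'k::field) \<Rightarrow> ('c \<Rightarrow>\<^sub>0 'k) \<Rightarrow> ('d \<Rightarrow>\<^sub>0 'k)) \<Rightarrow> bool" where
  "bilin f \<longleftrightarrow> (\<forall>v. lin (f v)) \<and> (\<forall>w. lin (\<lambda>v. f v w))"

definition lin_ext :: "('b \<Rightarrow> ('c \<Rightarrow>\<^sub>0 'k::field)) \<Rightarrow> ('b \<Rightarrow>\<^sub>0 'k) \<Rightarrow> ('c \<Rightarrow>\<^sub>0 'k)" where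
  "lin_ext f v = (\<Sum>b\<in>Poly_Mapping.keys v. scale (Poly_Mapping.lookup v b) (f b))"

definition tensor ::
  "('b \<Rightarrow>\<^sub>0 'k::field) \<Rightarrow> ('c \<Rightarrow>\<^sub>0 'k) \<Rightarrow> ('b \<times> 'c \<Rightarrow>\<^sub>0 'k)" (infixr \<open>\<otimes>\<close> 72) where
  "v \<otimes> w = (\<Sum>b\<in>Poly_Mapping.keys v. \<Sum>c\<in>Poly_Mapping.keys w.
     Poly_Mapping.single (b, c) (Poly_Mapping.lookup v b * Poly_Mapping.lookup w c))"

text \<open>
  \<open>tensor_lift f\<close> is the linear map on the tensor product induced by a bilinear map \<open>f\<close>. Sweedler's
  expression \<open>f(c_(1), c_(2))\<close> is \<open>tensor_lift f (\<triangle> c)\<close>.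
\<close>

definition tensor_lift ::
  "(('b \<Rightarrow>\<^sub>0 'k::field) \<Rightarrow> ('c \<Rightarrow>\<^sub>0 'k) \<Rightarrow> ('d \<Rightarrow>\<^sub>0 'k)) \<Rightarrow> ('b \<times> 'c \<Rightarrow>\<^sub>0 'k) \<Rightarrow> ('d \<Rightarrow>\<^sub>0 'k)" where
  "tensor_lift f = lin_ext (\<lambda>(b, c). f (basis b) (basis c))"

lemma lookup_scale [simp]: "Poly_Mapping.lookup (scale c v) b = c * Poly_Mapping.lookup v b"
  by (simp add: scale_def Poly_Mapping.map.rep_eq when_def)

lemma vector_space_scale: "vector_space (scale :: 'k::field \<Rightarrow> ('b \<Rightarrow>\<^sub>0 'k) \<Rightarrow> _)"
  by unfold_locales (auto intro!: poly_mapping_eqI simp: lookup_add algebra_simps)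

lemma lin_iff:
  "lin f \<longleftrightarrow> (\<forall>v w. f (v + w) = f v + f w) \<and> (\<forall>c v. f (scale c v) = scale c (f v))"
  by (simp add: Vector_Spaces.linear_def module_hom_def module_hom_axioms_def
      module_iff_vector_space vector_space_scale)

lemma lin_compose: "lin f \<Longrightarrow> lin g \<Longrightarrow> lin (\<lambda>v. f (g v))"
  by (simp add: lin_iff)

lemma lin_ext_eq:
  assumes "finite A" "Poly_Mapping.keys v \<subseteq> A"
  shows "lin_ext f v = (\<Sum>b\<in>A. scale (Poly_Mapping.lookup v b) (f b))"
  unfolding lin_ext_def
  by (rule sum.mono_neutral_left)
    (use assms in \<open>auto simp: in_keys_iff intro!: poly_mapping_eqI\<close>)

lemma lin_lin_ext:
  fixes f :: "'b \<Rightarrow> ('c \<Rightarrow>\<^sub>0 'k::field)"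
  shows "lin (lin_ext f)"
  unfolding lin_iff
proof (intro conjI allI)
  fix v w :: "'b \<Rightarrow>\<^sub>0 'k"
  let ?A = "Poly_Mapping.keys v \<union> Poly_Mapping.keys w"
  have "lin_ext f (v + w) = (\<Sum>b\<in>?A. scale (Poly_Mapping.lookup (v + w) b) (f b))"
    by (rule lin_ext_eq) (use Poly_Mapping.keys_add[of v w] in auto)
  also have "\<dots> = (\<Sum>b\<in>?A. scale (Poly_Mapping.lookup v b) (f b)) +
      (\<Sum>b\<in>?A. scale (Poly_Mapping.lookup w b) (f b))"
    unfolding sum.distrib[symmetric]
    by (rule sum.cong) (auto intro!: poly_mapping_eqI simp: lookup_add algebra_simps)
  also have "\<dots> = lin_ext f v + lin_ext f w"
    by (subst (1 2) lin_ext_eq[where A = ?A]) auto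
  finally show "lin_ext f (v + w) = lin_ext f v + lin_ext f w" .
next
  fix c and v :: "'b \<Rightarrow>\<^sub>0 'k"
  have "lin_ext f (scale c v) =
      (\<Sum>b\<in>Poly_Mapping.keys v. scale (Poly_Mapping.lookup (scale c v) b) (f b))"
    by (rule lin_ext_eq) (auto simp: in_keys_iff)
  also have "\<dots> = scale c (lin_ext f v)"
    unfolding lin_ext_def
    by (auto intro!: poly_mapping_eqI simp: lookup_sum sum_distrib_left mult.assoc)
  finally show "lin_ext f (scale c v) = scale c (lin_ext f v)" .
qed

lemma lin_ext_basis [simp]: "lin_ext f (basis b) = f b"
  by (auto simp: lin_ext_def basis_def intro!: poly_mapping_eqI)

lemma basis_expansion: "lin_ext basis v = v"
proof (rule poly_mapping_eqI)
  fix a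
  have "Poly_Mapping.lookup (lin_ext basis v) a =
      (\<Sum>b\<in>Poly_Mapping.keys v. if b = a then Poly_Mapping.lookup v a else 0)"
    unfolding lin_ext_def lookup_sum
    by (rule sum.cong) (auto simp: basis_def lookup_single when_def)
  also have "\<dots> = Poly_Mapping.lookup v a"
    by (simp add: in_keys_iff)
  finally show "Poly_Mapping.lookup (lin_ext basis v) a = Poly_Mapping.lookup v a" .
qed

lemma lin_ext_unique:
  fixes F :: "('b \<Rightarrow>\<^sub>0 'k::field) \<Rightarrow> ('c \<Rightarrow>\<^sub>0 'k)"
  assumes "lin F"
  shows "F v = lin_ext (\<lambda>b. F (basis b)) v"
proof -
  have "F (0 + 0) = F 0 + F 0"
    using assms unfolding lin_iff by blast
  then have F0: "F 0 = 0" by simp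
  have sum: "F (sum g A) = (\<Sum>a\<in>A. F (g a))" if "finite A" for g :: "'b \<Rightarrow> _" and A
    using that by induction (use assms F0 in \<open>auto simp: lin_iff\<close>)
  have "F v = F (\<Sum>b\<in>Poly_Mapping.keys v. scale (Poly_Mapping.lookup v b) (basis b))"
    using basis_expansion[of v] by (simp add: lin_ext_def)
  also have "\<dots> = (\<Sum>b\<in>Poly_Mapping.keys v. F (scale (Poly_Mapping.lookup v b) (basis b)))"
    by (rule sum) simp
  finally show ?thesis
    using assms unfolding lin_ext_def lin_iff by simp
qed

lemma lookup_tensor [simp]:
  "Poly_Mapping.lookup (v \<otimes> w) (b, c) = Poly_Mapping.lookup v b * Poly_Mapping.lookup w c"
proof -
  have "Poly_Mapping.lookup (v \<otimes> w) (b, c) =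
      (\<Sum>b'\<in>Poly_Mapping.keys v. \<Sum>c'\<in>Poly_Mapping.keys w.
        if c' = c then (if b' = b then Poly_Mapping.lookup v b * Poly_Mapping.lookup w c else 0)
        else 0)"
    by (auto simp: tensor_def lookup_sum lookup_single when_def intro!: sum.cong)
  also have "\<dots> = (\<Sum>b'\<in>Poly_Mapping.keys v.
      if b' = b then Poly_Mapping.lookup v b * Poly_Mapping.lookup w c else 0)"
    by (rule sum.cong) (auto simp: in_keys_iff)
  also have "\<dots> = Poly_Mapping.lookup v b * Poly_Mapping.lookup w c"
    by (auto simp: in_keys_iff)
  finally show ?thesis .
qed

lemma bilin_tensor: "bilin (\<otimes>)"
  unfolding bilin_def lin_iff
  by (auto intro!: poly_mapping_eqI simp: lookup_add algebra_simps)

lemma lin_tensor_right: "lin ((\<otimes>) v)" and lin_tensor_left: "lin (\<lambda>v. v \<otimes> w)"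
  using bilin_tensor unfolding bilin_def by auto

lemma tensor_basis: "basis b \<otimes> basis c = basis (b, c)"
  by (auto intro!: poly_mapping_eqI simp: basis_def lookup_single when_def)

lemma lin_eqI:
  assumes "lin F" "lin G" "\<And>b. F (basis b) = G (basis b)"
  shows "F v = G v"
proof -
  have "F v = lin_ext (\<lambda>b. F (basis b)) v"
    by (rule lin_ext_unique[OF assms(1)])
  also have "\<dots> = lin_ext (\<lambda>b. G (basis b)) v"
    by (simp only: assms(3))
  also have "\<dots> = G v"
    by (rule lin_ext_unique[OF assms(2), symmetric])
  finally show ?thesis .
qed

lemma lin_tensor_lift: "lin (tensor_lift f)"
  unfolding tensor_lift_def by (rule lin_lin_ext)

lemma tensor_lift_tensor:
  assumes "bilin f"
  shows "tensor_lift f (v \<otimes> w) = f v w"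
proof (rule lin_eqI[where F = "\<lambda>v. tensor_lift f (v \<otimes> w)" and G = "\<lambda>v. f v w"])
  show "lin (\<lambda>v. tensor_lift f (v \<otimes> w))"
    by (rule lin_compose[OF lin_tensor_lift lin_tensor_left])
  show "lin (\<lambda>v. f v w)"
    using assms unfolding bilin_def by simp
  fix b
  show "tensor_lift f (basis b \<otimes> w) = f (basis b) w"
  proof (rule lin_eqI[where F = "\<lambda>w. tensor_lift f (basis b \<otimes> w)" and G = "f (basis b)"])
    show "lin (\<lambda>w. tensor_lift f (basis b \<otimes> w))"
      by (rule lin_compose[OF lin_tensor_lift lin_tensor_right])
    show "lin (f (basis b))"
      using assms unfolding bilin_def by simp
    show "tensor_lift f (basis b \<otimes> basis c) = f (basis b) (basis c)" for c
      by (simp add: tensor_lift_def tensor_basis)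
  qed
qed

theorem tensor_universal:
  assumes "bilin f"
  shows "\<exists>!F. lin F \<and> (\<forall>v w. F (v \<otimes> w) = f v w)"
proof (rule ex1I[of _ "tensor_lift f"])
  show "lin (tensor_lift f) \<and> (\<forall>v w. tensor_lift f (v \<otimes> w) = f v w)"
    using tensor_lift_tensor[OF assms] lin_tensor_lift by blast
next
  fix F assume F: "lin F \<and> (\<forall>v w. F (v \<otimes> w) = f v w)"
  show "F = tensor_lift f"
  proof
    fix u
    have "F (basis p) = tensor_lift f (basis p)" for p
    proof (cases p)
      case (Pair b c)
      then show ?thesis
        using F tensor_lift_tensor[OF assms, of "basis b" "basis c"] by (simp flip: tensor_basis)
    qed
    then show "F u = tensor_lift f u"
      using lin_eqI[of F "tensor_lift f" u] lin_tensor_lift[of f] F by blast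
  qed
qed


section \<open>Coalgebras, bialgebras and Yetter-Drinfel'd racks\<close>

locale coalgebra =
  fixes comult :: "('b \<Rightarrow>\<^sub>0 'k::field) \<Rightarrow> ('b \<times> 'b \<Rightarrow>\<^sub>0 'k)"
    and counit :: "('b \<Rightarrow>\<^sub>0 'k) \<Rightarrow> 'k"
  assumes comult_linear: "lin comult"
    and counit_linear: "lin_form counit"
    and coassoc:
      "tensor_lift (\<lambda>c1 c2. tensor_lift (\<lambda>c11 c12. c11 \<otimes> (c12 \<otimes> c2)) (comult c1)) (comult c) =
       tensor_lift (\<lambda>c1 c2. c1 \<otimes> comult c2) (comult c)"
    and counit_left: "tensor_lift (\<lambda>c1 c2. scale (counit c1) c2) (comult c) = c"
    and counit_right: "tensor_lift (\<lambda>c1 c2. scale (counit c2) c1) (comult c) = c"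

definition group_like ::
  "(('b \<Rightarrow>\<^sub>0 'k::field) \<Rightarrow> ('b \<times> 'b \<Rightarrow>\<^sub>0 'k)) \<Rightarrow> (('b \<Rightarrow>\<^sub>0 'k) \<Rightarrow> 'k) \<Rightarrow> ('b \<Rightarrow>\<^sub>0 'k) \<Rightarrow> bool" where
  "group_like comult counit g \<longleftrightarrow> comult g = g \<otimes> g \<and> counit g = 1"

definition coalgebra_hom ::
  "(('b \<Rightarrow>\<^sub>0 'k::field) \<Rightarrow> ('b \<times> 'b \<Rightarrow>\<^sub>0 'k)) \<Rightarrow> (('b \<Rightarrow>\<^sub>0 'k) \<Rightarrow> 'k) \<Rightarrow>
   (('c \<Rightarrow>\<^sub>0 'k) \<Rightarrow> ('c \<times> 'c \<Rightarrow>\<^sub>0 'k)) \<Rightarrow> (('c \<Rightarrow>\<^sub>0 'k) \<Rightarrow> 'k) \<Rightarrow>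
   (('b \<Rightarrow>\<^sub>0 'k) \<Rightarrow> ('c \<Rightarrow>\<^sub>0 'k)) \<Rightarrow> bool" where
  "coalgebra_hom comult counit comult' counit' f \<longleftrightarrow> lin f \<and>
     (\<forall>c. comult' (f c) = tensor_lift (\<lambda>c1 c2. f c1 \<otimes> f c2) (comult c)) \<and>
     (\<forall>c. counit' (f c) = counit c)"

definition tensor_comult ::
  "(('b \<Rightarrow>\<^sub>0 'k::field) \<Rightarrow> ('b \<times> 'b \<Rightarrow>\<^sub>0 'k)) \<Rightarrow> (('c \<Rightarrow>\<^sub>0 'k) \<Rightarrow> ('c \<times> 'c \<Rightarrow>\<^sub>0 'k)) \<Rightarrow>
   ('b \<times> 'c \<Rightarrow>\<^sub>0 'k) \<Rightarrow> (('b \<times> 'c) \<times> ('b \<times> 'c) \<Rightarrow>\<^sub>0 'k)" where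
  "tensor_comult comult comult' =
     tensor_lift (\<lambda>a b. tensor_lift (\<lambda>a1 a2.
       tensor_lift (\<lambda>b1 b2. (a1 \<otimes> b1) \<otimes> (a2 \<otimes> b2)) (comult' b)) (comult a))"

definition tensor_counit ::
  "(('b \<Rightarrow>\<^sub>0 'k::field) \<Rightarrow> 'k) \<Rightarrow> (('c \<Rightarrow>\<^sub>0 'k) \<Rightarrow> 'k) \<Rightarrow> ('b \<times> 'c \<Rightarrow>\<^sub>0 'k) \<Rightarrow> 'k" where
  "tensor_counit counit counit' u =
     (\<Sum>(b, c)\<in>Poly_Mapping.keys u.
        Poly_Mapping.lookup u (b, c) * (counit (basis b) * counit' (basis c)))"

locale unital_algebra =
  fixes mult :: "('h \<Rightarrow>\<^sub>0 'k::field) \<Rightarrow> ('h \<Rightarrow>\<^sub>0 'k) \<Rightarrow> ('h \<Rightarrow>\<^sub>0 'k)"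
    and unit :: "'h \<Rightarrow>\<^sub>0 'k"
  assumes mult_bilinear: "bilin mult"
    and mult_assoc: "mult (mult f g) h = mult f (mult g h)"
    and unit_left: "mult unit h = h"
    and unit_right: "mult h unit = h"

definition tensor_mult ::
  "(('h \<Rightarrow>\<^sub>0 'k::field) \<Rightarrow> ('h \<Rightarrow>\<^sub>0 'k) \<Rightarrow> ('h \<Rightarrow>\<^sub>0 'k)) \<Rightarrow>
   ('h \<times> 'h \<Rightarrow>\<^sub>0 'k) \<Rightarrow> ('h \<times> 'h \<Rightarrow>\<^sub>0 'k) \<Rightarrow> ('h \<times> 'h \<Rightarrow>\<^sub>0 'k)" where
  "tensor_mult mult u v =
     tensor_lift (\<lambda>f f'. tensor_lift (\<lambda>g g'. mult f g \<otimes> mult f' g') v) u"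

locale bialgebra = unital_algebra mult unit + coalgebra comult counit
  for mult :: "('h \<Rightarrow>\<^sub>0 'k::field) \<Rightarrow> ('h \<Rightarrow>\<^sub>0 'k) \<Rightarrow> ('h \<Rightarrow>\<^sub>0 'k)"
    and unit :: "'h \<Rightarrow>\<^sub>0 'k"
    and comult :: "('h \<Rightarrow>\<^sub>0 'k) \<Rightarrow> ('h \<times> 'h \<Rightarrow>\<^sub>0 'k)"
    and counit :: "('h \<Rightarrow>\<^sub>0 'k) \<Rightarrow> 'k" +
  assumes comult_mult: "comult (mult f g) = tensor_mult mult (comult f) (comult g)"
    and comult_unit: "comult unit = unit \<otimes> unit"
    and counit_mult: "counit (mult f g) = counit f * counit g"
    and counit_unit: "counit unit = 1"

locale hopf_algebra = bialgebra mult unit comult counit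
  for mult :: "('h \<Rightarrow>\<^sub>0 'k::field) \<Rightarrow> ('h \<Rightarrow>\<^sub>0 'k) \<Rightarrow> ('h \<Rightarrow>\<^sub>0 'k)"
    and unit :: "'h \<Rightarrow>\<^sub>0 'k"
    and comult :: "('h \<Rightarrow>\<^sub>0 'k) \<Rightarrow> ('h \<times> 'h \<Rightarrow>\<^sub>0 'k)"
    and counit :: "('h \<Rightarrow>\<^sub>0 'k) \<Rightarrow> 'k" +
  assumes antipode: "\<exists>S. lin S \<and>
      (\<forall>h. tensor_lift (\<lambda>h1 h2. mult (S h1) h2) (comult h) = scale (counit h) unit) \<and>
      (\<forall>h. tensor_lift (\<lambda>h1 h2. mult h1 (S h2)) (comult h) = scale (counit h) unit)"

locale rack_bialgebra = coalgebra comult counit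
  for comult :: "('b \<Rightarrow>\<^sub>0 'k::field) \<Rightarrow> ('b \<times> 'b \<Rightarrow>\<^sub>0 'k)"
    and counit :: "('b \<Rightarrow>\<^sub>0 'k) \<Rightarrow> 'k"
    and one :: "'b \<Rightarrow>\<^sub>0 'k"
    and rack :: "('b \<Rightarrow>\<^sub>0 'k) \<Rightarrow> ('b \<Rightarrow>\<^sub>0 'k) \<Rightarrow> ('b \<Rightarrow>\<^sub>0 'k)" +
  assumes one_group_like: "group_like comult counit one"
    and rack_bilinear: "bilin rack"
    and rack_coalgebra_hom:
      "coalgebra_hom (tensor_comult comult comult) (tensor_counit counit counit) comult counit
         (tensor_lift rack)"
    and rack_self_distrib:
      "rack (rack a b) c = tensor_lift (\<lambda>c1 c2. rack (rack a c1) (rack b c2)) (comult c)"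
    and rack_one_right: "rack a one = a"
    and rack_one_left: "rack one a = scale (counit a) one"
    and counit_rack: "counit (rack a b) = counit a * counit b"

locale right_module = unital_algebra mult unit
  for mult :: "('h \<Rightarrow>\<^sub>0 'k::field) \<Rightarrow> ('h \<Rightarrow>\<^sub>0 'k) \<Rightarrow> ('h \<Rightarrow>\<^sub>0 'k)"
    and unit :: "'h \<Rightarrow>\<^sub>0 'k"
    and act :: "('b \<Rightarrow>\<^sub>0 'k) \<Rightarrow> ('h \<Rightarrow>\<^sub>0 'k) \<Rightarrow> ('b \<Rightarrow>\<^sub>0 'k)" +
  assumes act_bilinear: "bilin act"
    and act_mult: "act c (mult g h) = act (act c g) h"
    and act_unit: "act c unit = c"

locale yetter_drinfeld_rack =
  H: bialgebra mult unit comult\<^sub>H counit\<^sub>H +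
  C: rack_bialgebra comult counit one rack +
  M: right_module mult unit act
  for mult :: "('h \<Rightarrow>\<^sub>0 'k::field) \<Rightarrow> ('h \<Rightarrow>\<^sub>0 'k) \<Rightarrow> ('h \<Rightarrow>\<^sub>0 'k)"
    and unit :: "'h \<Rightarrow>\<^sub>0 'k"
    and comult\<^sub>H :: "('h \<Rightarrow>\<^sub>0 'k) \<Rightarrow> ('h \<times> 'h \<Rightarrow>\<^sub>0 'k)"
    and counit\<^sub>H :: "('h \<Rightarrow>\<^sub>0 'k) \<Rightarrow> 'k"
    and comult :: "('b \<Rightarrow>\<^sub>0 'k) \<Rightarrow> ('b \<times> 'b \<Rightarrow>\<^sub>0 'k)"
    and counit :: "('b \<Rightarrow>\<^sub>0 'k) \<Rightarrow> 'k"
    and one :: "'b \<Rightarrow>\<^sub>0 'k"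
    and rack :: "('b \<Rightarrow>\<^sub>0 'k) \<Rightarrow> ('b \<Rightarrow>\<^sub>0 'k) \<Rightarrow> ('b \<Rightarrow>\<^sub>0 'k)"
    and act :: "('b \<Rightarrow>\<^sub>0 'k) \<Rightarrow> ('h \<Rightarrow>\<^sub>0 'k) \<Rightarrow> ('b \<Rightarrow>\<^sub>0 'k)"
    and q :: "('b \<Rightarrow>\<^sub>0 'k) \<Rightarrow> ('h \<Rightarrow>\<^sub>0 'k)" +
  assumes act_coalgebra_hom:
      "coalgebra_hom (tensor_comult comult comult\<^sub>H) (tensor_counit counit counit\<^sub>H) comult counit
         (tensor_lift act)"
    and q_coalgebra_hom: "coalgebra_hom comult counit comult\<^sub>H counit\<^sub>H q"
    and q_one: "q one = unit"
    and rack_eq_act: "rack a b = act a (q b)"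
    and yetter_drinfeld:
      "tensor_lift (\<lambda>h1 h2. mult h1 (q (act a h2))) (comult\<^sub>H h) = mult (q a) h"


section \<open>The polynomial Hopf algebra\<close>

datatype indet = iX | iY | iZ

text \<open>
  The product \<open>(*)\<close> of \<^theory>\<open>HOL-Library.Poly_Mapping\<close> is convolution along the addition of
  exponents, so this type with \<open>(*)\<close> and \<open>1\<close> is the polynomial ring \<open>k[X,Y,Z]\<close>.
\<close>

type_synonym 'k pXYZ = "(indet \<Rightarrow>\<^sub>0 nat) \<Rightarrow>\<^sub>0 'k"

definition gen :: "indet \<Rightarrow> 'k::field pXYZ" where
  "gen i = basis (Poly_Mapping.single i 1)"

text \<open>
  On the tensor square, \<open>(*)\<close> is convolution along the componentwise addition of pairs of exponents,
  that is, the tensor product algebra structure (see \<open>tensor_mult_times\<close>). So \<open>pXYZ_comult\<close> is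
  the algebra homomorphism with the values \<open>gen_comult\<close> on the generators.
\<close>

fun gen_comult :: "indet \<Rightarrow> ((indet \<Rightarrow>\<^sub>0 nat) \<times> (indet \<Rightarrow>\<^sub>0 nat) \<Rightarrow>\<^sub>0 'k::field)" where
  "gen_comult iX = 1 \<otimes> gen iX + gen iX \<otimes> 1 + gen iY \<otimes> gen iZ"
| "gen_comult iY = 1 \<otimes> gen iY + gen iY \<otimes> 1"
| "gen_comult iZ = 1 \<otimes> gen iZ + gen iZ \<otimes> 1"

definition pXYZ_comult ::
  "'k::field pXYZ \<Rightarrow> ((indet \<Rightarrow>\<^sub>0 nat) \<times> (indet \<Rightarrow>\<^sub>0 nat) \<Rightarrow>\<^sub>0 'k)" where
  "pXYZ_comult = lin_ext (\<lambda>m. gen_comult iX ^ Poly_Mapping.lookup m iX *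
     gen_comult iY ^ Poly_Mapping.lookup m iY * gen_comult iZ ^ Poly_Mapping.lookup m iZ)"

text \<open>The counit, forced by the coproduct, is evaluation at the origin.\<close>

definition pXYZ_counit :: "'k::field pXYZ \<Rightarrow> 'k" where
  "pXYZ_counit p = Poly_Mapping.lookup p 0"

lemma pXYZ_comult_gen: "pXYZ_comult (gen i) = gen_comult i"
  by (cases i) (simp_all add: pXYZ_comult_def gen_def lookup_single)

lemma pXYZ_counit_gen: "pXYZ_counit (gen i) = 0"
proof -
  have "Poly_Mapping.single i (1::nat) \<noteq> 0"
    by (metis lookup_single_eq lookup_zero zero_neq_one)
  then show ?thesis
    by (simp add: pXYZ_counit_def gen_def basis_def lookup_single_not_eq)
qed

lemma bilin_times: "bilin ((*) :: ('h::comm_monoid_add \<Rightarrow>\<^sub>0 'k::field) \<Rightarrow> _ \<Rightarrow> _)"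
  unfolding bilin_def lin_iff
  by (simp add: scale_def mult_map_scale_conv_mult algebra_simps)

lemma basis_times: "basis a * basis b = basis (a + b)"
  by (simp add: basis_def mult_single)

lemma tensor_mult_times:
  fixes u v :: "'h::comm_monoid_add \<times> 'h \<Rightarrow>\<^sub>0 'k::field"
  shows "tensor_mult (*) u v = u * v"
proof -
  have "u * v = lin_ext (\<lambda>p. basis p * v) u"
    using bilin_times by (intro lin_ext_unique) (auto simp: bilin_def)
  also have "(\<lambda>p. basis p * v) = (\<lambda>p. lin_ext (\<lambda>p'. basis p * basis p') v)"
    using bilin_times by (intro ext lin_ext_unique) (auto simp: bilin_def)
  finally show ?thesis
    by (simp add: tensor_mult_def tensor_lift_def basis_times tensor_basis case_prod_unfold
        plus_prod_def)
qed


section \<open>The five-dimensional rack bialgebra\<close>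

datatype cbasis = e1 | ex | ey | ez | et

type_synonym 'k C5 = "cbasis \<Rightarrow>\<^sub>0 'k"

fun C5_comult_basis :: "cbasis \<Rightarrow> (cbasis \<times> cbasis \<Rightarrow>\<^sub>0 'k::field)" where
  "C5_comult_basis e1 = basis e1 \<otimes> basis e1"
| "C5_comult_basis ex = basis e1 \<otimes> basis ex + basis ex \<otimes> basis e1 + basis ey \<otimes> basis ez"
| "C5_comult_basis ey = basis e1 \<otimes> basis ey + basis ey \<otimes> basis e1"
| "C5_comult_basis ez = basis e1 \<otimes> basis ez + basis ez \<otimes> basis e1"
| "C5_comult_basis et = basis e1 \<otimes> basis et + basis et \<otimes> basis e1"

definition C5_comult :: "'k::field C5 \<Rightarrow> (cbasis \<times> cbasis \<Rightarrow>\<^sub>0 'k)" where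
  "C5_comult = lin_ext C5_comult_basis"

definition C5_counit :: "'k::field C5 \<Rightarrow> 'k" where
  "C5_counit v = Poly_Mapping.lookup v e1"

fun C5_rack_basis :: "cbasis \<Rightarrow> cbasis \<Rightarrow> 'k::field C5" where
  "C5_rack_basis a e1 = basis a"
| "C5_rack_basis ex ey = basis et"
| "C5_rack_basis ex ez = basis et"
| "C5_rack_basis _ _ = 0"

definition C5_rack :: "'k::field C5 \<Rightarrow> 'k C5 \<Rightarrow> 'k C5" where
  "C5_rack v w = lin_ext (\<lambda>(a, b). C5_rack_basis a b) (v \<otimes> w)"

fun C5_q_basis :: "cbasis \<Rightarrow> 'k::field pXYZ" where
  "C5_q_basis e1 = 1"
| "C5_q_basis ex = gen iX"
| "C5_q_basis ey = gen iY"
| "C5_q_basis ez = gen iZ"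
| "C5_q_basis et = 0"

definition C5_q :: "'k::field C5 \<Rightarrow> 'k pXYZ" where
  "C5_q = lin_ext C5_q_basis"

end

theory Submission
  imports Defs
begin

text \<open>
  Let \<open>N = - \<lhd> y\<close>, the endomorphism of \<open>C\<close> sending \<open>x\<close> to \<open>t\<close> and killing the other basis vectors.
  Since \<open>N\<^sup>2 = 0\<close>, letting \<open>X, Y, Z\<close> act as \<open>N\<^sup>2, N, N\<close> makes \<open>C\<close> a module whose action extends the
  rack product along \<open>q\<close>. In each summand of \<open>\<triangle> a\<close>, for \<open>a\<close> a basis vector, \<open>N\<close> kills one of the two
  factors, so compatibility of the action with the coproducts reduces to the counit axioms of \<open>H\<close>.
  The Yetter-Drinfel'd condition holds because \<open>q \<circ> N = 0\<close> gives \<open>q (a \<cdot> h) = \<epsilon>(h) q(a)\<close>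
  and \<open>H\<close> is commutative.

  The Hopf algebra axioms for \<open>k[X,Y,Z]\<close> are identities between algebra homomorphisms, hence need
  to be checked only on the generators; the antipode is
  \<open>X \<mapsto> YZ - X\<close>, \<open>Y \<mapsto> -Y\<close>, \<open>Z \<mapsto> -Z\<close>.
\<close>

section \<open>Linear maps\<close>

lemma lin_add: "lin F \<Longrightarrow> F (v + w) = F v + F w"
  and lin_scale: "lin F \<Longrightarrow> F (scale c v) = scale c (F v)"
  by (simp_all add: lin_iff)

lemma scale_simps [simp]:
  "scale c (v + w) = scale c v + scale c w" "scale c 0 = 0" "scale 0 v = 0" "scale 1 v = v"
  "scale c (scale d v) = scale (c * d) v"
  by (auto intro!: poly_mapping_eqI simp: lookup_add algebra_simps)

lemma scale_add_left: "scale (c + d) v = scale c v + scale d v"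
  by (auto intro!: poly_mapping_eqI simp: lookup_add algebra_simps)

lemma lin_zero: "lin F \<Longrightarrow> F 0 = 0"
  using lin_scale[of F 0 0] by simp

lemma scale_sum: "scale c (sum f A) = (\<Sum>a\<in>A. scale c (f a))"
  by (auto intro!: poly_mapping_eqI simp: lookup_sum sum_distrib_left)

text \<open>Both counits are coefficient functionals, at exponent \<open>0\<close> and at
  \<open>e1\<close>; this gives their linearity.\<close>

lemma lin_lookup: "lin_form (\<lambda>v :: 'b \<Rightarrow>\<^sub>0 'k::field. Poly_Mapping.lookup v b)"
proof -
  have "vector_space ((*) :: 'k \<Rightarrow> 'k \<Rightarrow> 'k)"
    by unfold_locales (auto simp: algebra_simps)
  then show ?thesis
    by (simp add: Vector_Spaces.linear_def module_hom_def module_hom_axioms_def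
      module_iff_vector_space vector_space_scale lookup_add)
qed

lemma lin_ext_param:
  assumes "\<And>b. lin (\<lambda>a. f a b)"
  shows "lin (\<lambda>a. lin_ext (f a) u)"
  using assms unfolding lin_iff lin_ext_def
  by (simp add: sum.distrib scale_sum mult.commute)

lemma tensor_lift_basis [simp]: "tensor_lift f (basis (b, c)) = f (basis b) (basis c)"
  by (simp add: tensor_lift_def)

lemma tensor_lift_linear [simp]:
  "tensor_lift f (u + v) = tensor_lift f u + tensor_lift f v"
  "tensor_lift f (scale c u) = scale c (tensor_lift f u)"
  "tensor_lift f 0 = 0"
  using lin_tensor_lift[of f] by (simp_all add: lin_add lin_scale lin_zero)

lemma tensor_linear [simp]:
  "(u + v) \<otimes> w = u \<otimes> w + v \<otimes> w" "w \<otimes> (u + v) = w \<otimes> u + w \<otimes> v"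
  "scale c u \<otimes> w = scale c (u \<otimes> w)" "w \<otimes> scale c u = scale c (w \<otimes> u)"
  "0 \<otimes> w = 0" "w \<otimes> 0 = 0"
  by (auto intro!: poly_mapping_eqI simp: lookup_add algebra_simps)

lemma tensor_lift_param:
  assumes "\<And>b c. lin (\<lambda>a. f a (basis b) (basis c))"
  shows "lin (\<lambda>a. tensor_lift (f a) u)"
  unfolding tensor_lift_def by (rule lin_ext_param) (use assms in auto)

text \<open>\<open>tensor_lift\<close> reads its integrand only at basis pairs, so facts known only
  for basis vectors may be used under a Sweedler sum.\<close>

lemma tensor_lift_cong:
  assumes "\<And>b c. f (basis b) (basis c) = g (basis b) (basis c)"
  shows "tensor_lift f = tensor_lift g"
  by (rule ext, rule lin_eqI[OF lin_tensor_lift lin_tensor_lift])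
    (use assms in \<open>auto simp: tensor_lift_def\<close>)

lemma lin_tensor_lift_compose:
  assumes "lin F"
  shows "F (tensor_lift f u) = tensor_lift (\<lambda>a b. F (f a b)) u"
  by (rule lin_eqI[OF lin_compose[OF assms lin_tensor_lift] lin_tensor_lift])
    (auto simp: tensor_lift_def)

text \<open>\<open>tensor_counit\<close> is a scalar given by a sum over keys, out of reach of
  \<open>lin_eqI\<close>; so \<open>F u\<close> is expanded in the basis. Serves the counit laws of
  the rack product and of the action.\<close>

lemma tensor_counit_lin:
  assumes "lin F"
    and "\<And>b c. Poly_Mapping.lookup (F (basis (b, c))) d = f (basis b) * g (basis c)"
  shows "Poly_Mapping.lookup (F u) d = tensor_counit f g u"
  by (subst lin_ext_unique[OF assms(1)])
    (auto simp: lin_ext_def lookup_sum tensor_counit_def assms(2) intro!: sum.cong)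


section \<open>Algebra homomorphisms\<close>

text \<open>Multiplication is convolution for every type of exponents, so this also covers maps into
  tensor squares and nested tensor cubes.\<close>

definition alg_hom ::
  "(('g::comm_monoid_add \<Rightarrow>\<^sub>0 'k::field) \<Rightarrow> ('h::comm_monoid_add \<Rightarrow>\<^sub>0 'k)) \<Rightarrow> bool" where
  "alg_hom F \<longleftrightarrow> lin F \<and> F 1 = 1 \<and> (\<forall>f g. F (f * g) = F f * F g)"

lemma one_basis: "1 = basis 0"
  by (simp add: basis_def)

lemma scale_times [simp]:
  fixes f g :: "'h::comm_monoid_add \<Rightarrow>\<^sub>0 'k::field"
  shows "scale c f * g = scale c (f * g)" "f * scale c g = scale c (f * g)"
  using bilin_times unfolding bilin_def lin_iff by blast+

lemma alg_homI:
  assumes F: "lin F" and one: "F (basis 0) = 1"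
    and mult: "\<And>a b. F (basis (a + b)) = F (basis a) * F (basis b)"
  shows "alg_hom F"
proof -
  have "F (f * g) = F f * F g" for f g
  proof (rule lin_eqI[where F = "\<lambda>f. F (f * g)" and G = "\<lambda>f. F f * F g"])
    show "F (basis a * g) = F (basis a) * F g" for a
      by (rule lin_eqI[where F = "\<lambda>g. F (basis a * g)" and G = "\<lambda>g. F (basis a) * F g"])
        (use F in \<open>auto simp: lin_iff algebra_simps basis_times mult\<close>)
  qed (use F in \<open>auto simp: lin_iff algebra_simps\<close>)
  then show ?thesis
    using F one by (simp add: alg_hom_def one_basis)
qed

lemma alg_hom_lin: "alg_hom F \<Longrightarrow> lin F"
  and alg_hom_one: "alg_hom F \<Longrightarrow> F 1 = 1"
  and alg_hom_mult: "alg_hom F \<Longrightarrow> F (f * g) = F f * F g"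
  by (simp_all add: alg_hom_def)

lemma alg_hom_power: "alg_hom F \<Longrightarrow> F (f ^ n) = F f ^ n"
  by (induction n) (auto simp: alg_hom_one alg_hom_mult)

lemma alg_hom_id: "alg_hom (\<lambda>f. f)"
  by (simp add: alg_hom_def lin_iff)

lemma alg_hom_compose: "alg_hom F \<Longrightarrow> alg_hom G \<Longrightarrow> alg_hom (\<lambda>f. F (G f))"
  by (simp add: alg_hom_def lin_iff)

text \<open>Commutativity of the target lets \<open>G b\<close> pass \<open>F a'\<close>. Sweedler
  sums brought into this form become algebra homomorphisms.\<close>

lemma alg_hom_tensor_lift:
  assumes "alg_hom F" "alg_hom G"
  shows "alg_hom (tensor_lift (\<lambda>a b. F a * G b))"
proof (rule alg_homI[OF lin_tensor_lift])
  show "tensor_lift (\<lambda>a b. F a * G b) (basis 0) = 1"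
    using assms by (simp add: zero_prod_def alg_hom_one flip: one_basis)
  show "tensor_lift (\<lambda>a b. F a * G b) (basis (p + p')) =
      tensor_lift (\<lambda>a b. F a * G b) (basis p) * tensor_lift (\<lambda>a b. F a * G b) (basis p')" for p p'
    using assms
    by (cases p; cases p') (simp add: alg_hom_mult algebra_simps flip: basis_times)
qed

lemma alg_hom_tensor_one: "alg_hom (\<lambda>a. a \<otimes> 1)" and alg_hom_one_tensor: "alg_hom (\<lambda>b. 1 \<otimes> b)"
  by (auto intro!: alg_homI simp: lin_iff one_basis tensor_basis basis_times zero_prod_def)

section \<open>Generators and evaluation of polynomials\<close>

lemma basis_monomial:
  "basis m = gen iX ^ Poly_Mapping.lookup m iX * gen iY ^ Poly_Mapping.lookup m iY *
     gen iZ ^ Poly_Mapping.lookup m iZ"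
proof -
  have gen_power: "gen i ^ n = basis (Poly_Mapping.single i n)" for i n
    by (induction n)
      (simp_all add: gen_def one_basis basis_times flip: single_add)
  have "m = Poly_Mapping.single iX (Poly_Mapping.lookup m iX) +
      Poly_Mapping.single iY (Poly_Mapping.lookup m iY) +
      Poly_Mapping.single iZ (Poly_Mapping.lookup m iZ)"
    (is "m = ?m")
  proof (rule poly_mapping_eqI)
    fix i
    show "Poly_Mapping.lookup m i = Poly_Mapping.lookup ?m i"
      by (cases i) (simp_all add: lookup_add lookup_single)
  qed
  then show ?thesis
    by (simp add: gen_power basis_times)
qed

lemma alg_hom_eqI:
  assumes "alg_hom F" "alg_hom G" "\<And>i. F (gen i) = G (gen i)"
  shows "F p = G p"
proof (rule lin_eqI[of F G])
  show "F (basis m) = G (basis m)" for m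
    using assms by (simp add: basis_monomial[of m] alg_hom_mult alg_hom_power)
qed (use assms in \<open>auto dest: alg_hom_lin\<close>)

text \<open>The homomorphism from the universal property of the polynomial ring;
  \<open>gen_comult\<close> yields the coproduct, \<open>gen_antipode\<close> the antipode.\<close>

definition gen_eval ::
  "(indet \<Rightarrow> ('h::comm_monoid_add \<Rightarrow>\<^sub>0 'k::field)) \<Rightarrow> 'k pXYZ \<Rightarrow> ('h \<Rightarrow>\<^sub>0 'k)" where
  "gen_eval g = lin_ext (\<lambda>m. g iX ^ Poly_Mapping.lookup m iX *
     g iY ^ Poly_Mapping.lookup m iY * g iZ ^ Poly_Mapping.lookup m iZ)"

lemma alg_hom_gen_eval: "alg_hom (gen_eval g)"
  by (rule alg_homI)
    (simp_all add: gen_eval_def lin_lin_ext lookup_add power_add algebra_simps)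

lemma gen_eval_gen: "gen_eval g (gen i) = g i"
  by (cases i) (simp_all add: gen_eval_def gen_def lookup_single)


section \<open>The Hopf algebra\<close>

lemma alg_hom_comult: "alg_hom pXYZ_comult"
  using alg_hom_gen_eval[of gen_comult] by (simp add: gen_eval_def pXYZ_comult_def)

lemma pXYZ_counit_basis: "pXYZ_counit (basis m) = (if m = 0 then 1 else 0)"
  by (simp add: pXYZ_counit_def basis_def lookup_single when_def)

lemma exponent_add_eq_0_iff: "a + b = 0 \<longleftrightarrow> a = 0 \<and> b = (0 :: 'i \<Rightarrow>\<^sub>0 nat)"
  by (auto simp: poly_mapping_eq_iff lookup_add fun_eq_iff)

text \<open>The field is embedded as the multiples of \<open>1\<close> so that the counit fits
  \<open>alg_hom\<close>. Natural exponents cannot cancel, so a product of monomials is constant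
  only if both are.\<close>

lemma alg_hom_counit: "alg_hom (\<lambda>p. scale (pXYZ_counit p) 1)"
proof (rule alg_homI)
  show "lin (\<lambda>p. scale (pXYZ_counit p) 1)"
    by (simp add: lin_iff pXYZ_counit_def lookup_add scale_add_left)
qed (auto simp: pXYZ_counit_basis exponent_add_eq_0_iff)

lemma pXYZ_counit_mult: "pXYZ_counit (f * g) = pXYZ_counit f * pXYZ_counit g"
  using arg_cong[OF alg_hom_mult[OF alg_hom_counit, of f g], of pXYZ_counit]
  by (simp add: pXYZ_counit_def lookup_one)

lemma pXYZ_coassoc:
  "tensor_lift (\<lambda>c1 c2. tensor_lift (\<lambda>c11 c12. c11 \<otimes> (c12 \<otimes> c2)) (pXYZ_comult c1)) (pXYZ_comult p)
   = tensor_lift (\<lambda>c1 c2. c1 \<otimes> pXYZ_comult c2) (pXYZ_comult (p :: 'k::field pXYZ))"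
  (is "tensor_lift ?f _ = tensor_lift ?g _")
proof (rule alg_hom_eqI[where F = "\<lambda>p. tensor_lift ?f (pXYZ_comult p)"
      and G = "\<lambda>p. tensor_lift ?g (pXYZ_comult p)"])
  \<comment> \<open>\<open>R\<close> sends \<open>a \<otimes> b\<close> to
    \<open>a \<otimes> (b \<otimes> 1)\<close>. With it, \<open>f\<close> and \<open>g\<close> below
    factor the integrands into images of homomorphisms.\<close>
  define R :: "((indet \<Rightarrow>\<^sub>0 nat) \<times> (indet \<Rightarrow>\<^sub>0 nat) \<Rightarrow>\<^sub>0 'k) \<Rightarrow> _" where
    "R = tensor_lift (\<lambda>a b. (a \<otimes> 1) * (1 \<otimes> (b \<otimes> (1 :: 'k pXYZ))))"
  have R: "alg_hom R"
    unfolding R_def by (intro alg_hom_tensor_lift alg_hom_tensor_one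
        alg_hom_compose[OF alg_hom_one_tensor alg_hom_tensor_one])
  have f: "tensor_lift ?f = tensor_lift (\<lambda>a b. R (pXYZ_comult a) * (1 \<otimes> (1 \<otimes> b)))"
  proof (rule tensor_lift_cong)
    fix m n
    show "?f (basis m) (basis n) = R (pXYZ_comult (basis m)) * (1 \<otimes> (1 \<otimes> basis n))"
      by (rule lin_eqI[where G = "\<lambda>u. R u * (1 \<otimes> (1 \<otimes> basis n))"])
        (auto simp: lin_iff R_def one_basis tensor_basis basis_times algebra_simps)
  qed
  show "alg_hom (\<lambda>p. tensor_lift ?f (pXYZ_comult p))"
    unfolding f
    by (intro alg_hom_compose[OF alg_hom_tensor_lift alg_hom_comult] alg_hom_compose[OF R]
        alg_hom_comult alg_hom_compose[OF alg_hom_one_tensor alg_hom_one_tensor])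
  have g: "tensor_lift ?g = tensor_lift (\<lambda>a b. (a \<otimes> 1) * (1 \<otimes> pXYZ_comult b))"
  proof (rule tensor_lift_cong)
    fix m n
    show "?g (basis m) (basis n) = (basis m \<otimes> 1) * (1 \<otimes> pXYZ_comult (basis n))"
      by (rule lin_eqI[where F = "\<lambda>u. basis m \<otimes> u" and G = "\<lambda>u. (basis m \<otimes> 1) * (1 \<otimes> u)"])
        (auto simp: lin_iff one_basis tensor_basis basis_times algebra_simps zero_prod_def)
  qed
  show "alg_hom (\<lambda>p. tensor_lift ?g (pXYZ_comult p))"
    unfolding g
    by (intro alg_hom_compose[OF alg_hom_tensor_lift alg_hom_comult] alg_hom_tensor_one
        alg_hom_compose[OF alg_hom_one_tensor alg_hom_comult])
  \<comment> \<open>The check on generators unfolds \<open>gen\<close> to basis vectors, so the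
    coproduct values are restated in that form.\<close>
  have comult_basis: "pXYZ_comult (basis 0) = (basis 0 :: _ \<Rightarrow>\<^sub>0 'k)"
    "pXYZ_comult (basis (Poly_Mapping.single i (Suc 0))) = (gen_comult i :: _ \<Rightarrow>\<^sub>0 'k)" for i
    using alg_hom_one[OF alg_hom_comult] pXYZ_comult_gen[of i] by (simp_all add: one_basis gen_def)
  show "tensor_lift ?f (pXYZ_comult (gen i)) = tensor_lift ?g (pXYZ_comult (gen i))" for i
    by (cases i) (simp_all add: gen_def one_basis tensor_basis comult_basis zero_prod_def add_ac)
qed

lemma pXYZ_counit_left: "tensor_lift (\<lambda>c1 c2. scale (pXYZ_counit c1) c2) (pXYZ_comult p) = p"
  and pXYZ_counit_right: "tensor_lift (\<lambda>c1 c2. scale (pXYZ_counit c2) c1) (pXYZ_comult p) = p"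
  for p :: "'k::field pXYZ"
proof -
  note simps = gen_def one_basis tensor_basis pXYZ_counit_basis
  have single_neq: "Poly_Mapping.single i (Suc 0) \<noteq> 0" for i :: indet
    by (metis lookup_single_eq lookup_zero nat.simps(3))
  \<comment> \<open>The scalar becomes a factor that is a homomorphism by
    \<open>alg_hom_counit\<close>.\<close>
  have eq: "tensor_lift (\<lambda>c1 c2. scale (pXYZ_counit c1) c2) =
      tensor_lift (\<lambda>c1 c2. scale (pXYZ_counit c1) 1 * (c2 :: 'k pXYZ))"
    "tensor_lift (\<lambda>c1 c2. scale (pXYZ_counit c2) c1) =
      tensor_lift (\<lambda>c1 c2. (c1 :: 'k pXYZ) * scale (pXYZ_counit c2) 1)"
    by simp_all
  show "tensor_lift (\<lambda>c1 c2. scale (pXYZ_counit c1) c2) (pXYZ_comult p) = p"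
  proof (rule alg_hom_eqI[OF _ alg_hom_id])
    show "alg_hom (\<lambda>p::'k pXYZ. tensor_lift (\<lambda>c1 c2. scale (pXYZ_counit c1) c2) (pXYZ_comult p))"
      unfolding eq
      by (intro alg_hom_compose[OF alg_hom_tensor_lift alg_hom_comult] alg_hom_counit alg_hom_id)
    show "tensor_lift (\<lambda>c1 c2. scale (pXYZ_counit c1) c2) (pXYZ_comult (gen i)) = gen i" for i
      \<comment> \<open>\<open>pXYZ_comult_gen\<close> has to fire while the generators are folded;
        the second pass unfolds them.\<close>
      by (cases i) (simp_all add: pXYZ_comult_gen, simp_all add: simps single_neq)
  qed
  show "tensor_lift (\<lambda>c1 c2. scale (pXYZ_counit c2) c1) (pXYZ_comult p) = p"
  proof (rule alg_hom_eqI[OF _ alg_hom_id])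
    show "alg_hom (\<lambda>p::'k pXYZ. tensor_lift (\<lambda>c1 c2. scale (pXYZ_counit c2) c1) (pXYZ_comult p))"
      unfolding eq
      by (intro alg_hom_compose[OF alg_hom_tensor_lift alg_hom_comult] alg_hom_counit alg_hom_id)
    show "tensor_lift (\<lambda>c1 c2. scale (pXYZ_counit c2) c1) (pXYZ_comult (gen i)) = gen i" for i
      by (cases i) (simp_all add: pXYZ_comult_gen, simp_all add: simps single_neq)
  qed
qed

text \<open>Forced by the antipode law: primitivity of \<open>Y\<close> and \<open>Z\<close> gives
  the signs, and at \<open>X\<close> the law reads \<open>S X + X + S Y * Z = 0\<close>.\<close>

fun gen_antipode :: "indet \<Rightarrow> 'k::field pXYZ" where
  "gen_antipode iX = gen iY * gen iZ - gen iX"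
| "gen_antipode iY = - gen iY"
| "gen_antipode iZ = - gen iZ"

lemma pXYZ_antipode:
  defines "S \<equiv> gen_eval gen_antipode"
  shows "tensor_lift (\<lambda>h1 h2. S h1 * h2) (pXYZ_comult p) = scale (pXYZ_counit p) 1"
    and "tensor_lift (\<lambda>h1 h2. h1 * S h2) (pXYZ_comult p) = scale (pXYZ_counit p) 1"
proof -
  have S: "alg_hom S"
    unfolding S_def by (rule alg_hom_gen_eval)
  have S_gen: "S (gen i) = gen_antipode i" for i
    unfolding S_def by (rule gen_eval_gen)
  \<comment> \<open>\<open>gen_comult\<close> is a sum of pure tensors, on which bilinearity
    evaluates the lift directly.\<close>
  have "bilin (\<lambda>h1 h2. S h1 * h2)" "bilin (\<lambda>h1 h2. h1 * S h2)"
    using alg_hom_lin[OF S] by (auto simp: bilin_def lin_iff algebra_simps)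
  note lift = this[THEN tensor_lift_tensor]
  show "tensor_lift (\<lambda>h1 h2. S h1 * h2) (pXYZ_comult p) = scale (pXYZ_counit p) 1"
  proof (rule alg_hom_eqI[OF _ alg_hom_counit])
    show "alg_hom (\<lambda>p. tensor_lift (\<lambda>h1 h2. S h1 * h2) (pXYZ_comult p))"
      by (intro alg_hom_compose[OF alg_hom_tensor_lift alg_hom_comult] S alg_hom_id)
    show "tensor_lift (\<lambda>h1 h2. S h1 * h2) (pXYZ_comult (gen i)) = scale (pXYZ_counit (gen i)) 1"
      for i
      by (cases i) (simp_all add: pXYZ_comult_gen pXYZ_counit_gen lift alg_hom_one[OF S] S_gen)
  qed
  show "tensor_lift (\<lambda>h1 h2. h1 * S h2) (pXYZ_comult p) = scale (pXYZ_counit p) 1"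
  proof (rule alg_hom_eqI[OF _ alg_hom_counit])
    show "alg_hom (\<lambda>p. tensor_lift (\<lambda>h1 h2. h1 * S h2) (pXYZ_comult p))"
      by (intro alg_hom_compose[OF alg_hom_tensor_lift alg_hom_comult] S alg_hom_id)
    show "tensor_lift (\<lambda>h1 h2. h1 * S h2) (pXYZ_comult (gen i)) = scale (pXYZ_counit (gen i)) 1"
      for i
      by (cases i) (simp_all add: pXYZ_comult_gen pXYZ_counit_gen lift alg_hom_one[OF S] S_gen)
  qed
qed

lemma pXYZ_hopf_algebra: "hopf_algebra (*) 1 (pXYZ_comult :: 'k::field pXYZ \<Rightarrow> _) pXYZ_counit"
proof (intro hopf_algebra.intro bialgebra.intro unital_algebra.intro coalgebra.intro
    bialgebra_axioms.intro hopf_algebra_axioms.intro, goal_cases)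
  case 1 show ?case by (rule bilin_times)
next
  case (2 f g h) show ?case by (rule mult.assoc)
next
  case (3 h) show ?case by simp
next
  case (4 h) show ?case by simp
next
  case 5 show ?case by (rule alg_hom_lin[OF alg_hom_comult])
next
  case 6 show ?case using lin_lookup[of 0] by (simp add: pXYZ_counit_def[abs_def])
next
  case (7 c) show ?case by (rule pXYZ_coassoc)
next
  case (8 c) show ?case by (rule pXYZ_counit_left)
next
  case (9 c) show ?case by (rule pXYZ_counit_right)
next
  case (10 f g) show ?case by (simp add: tensor_mult_times alg_hom_mult[OF alg_hom_comult])
next
  \<comment> \<open>Preservation of the unit by the embedding \<open>a \<otimes> 1\<close> says that
    \<open>1 \<otimes> 1\<close> is the unit of the tensor square.\<close>
  case 11 show ?case
    by (simp add: alg_hom_one[OF alg_hom_comult] alg_hom_one[OF alg_hom_tensor_one])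
next
  case (12 f g) show ?case by (rule pXYZ_counit_mult)
next
  case 13 show ?case by (simp add: pXYZ_counit_def)
next
  case 14 show ?case using pXYZ_antipode alg_hom_lin[OF alg_hom_gen_eval] by blast
qed


section \<open>The rack bialgebra\<close>

lemma C5_comult_basis_simp [simp]: "C5_comult (basis b) = C5_comult_basis b"
  by (simp add: C5_comult_def)

lemma lin_C5_comult: "lin C5_comult"
  by (simp add: C5_comult_def lin_lin_ext)

lemma C5_counit_basis: "C5_counit (basis b) = (if b = e1 then 1 else 0)"
  by (simp add: C5_counit_def basis_def lookup_single when_def)

lemma C5_counit_linear [simp]:
  "C5_counit (v + w) = C5_counit v + C5_counit w" "C5_counit (scale c v) = c * C5_counit v"
  by (simp_all add: C5_counit_def lookup_add)

text \<open>Coassociativity is delicate only at \<open>x\<close>: since \<open>y\<close> and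
  \<open>z\<close> are primitive, \<open>y \<otimes> z\<close> contributes the same three terms with
  an added factor \<open>1\<close> to both sides.\<close>

lemma C5_coalgebra: "coalgebra (C5_comult :: 'k::field C5 \<Rightarrow> _) C5_counit"
proof (rule coalgebra.intro, goal_cases)
  case 1 show ?case by (rule lin_C5_comult)
next
  case 2 show ?case using lin_lookup[of e1] by (simp add: C5_counit_def[abs_def])
next
  case (3 c)
  show ?case
  proof (rule lin_eqI[OF lin_compose[OF lin_tensor_lift lin_C5_comult]
        lin_compose[OF lin_tensor_lift lin_C5_comult]], goal_cases)
    case (1 b) show ?case by (cases b) (simp_all add: tensor_basis add_ac)
  qed
next
  case (4 c)
  show ?case
  proof (rule lin_eqI[where G = "\<lambda>c. c", OF lin_compose[OF lin_tensor_lift lin_C5_comult]],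
      goal_cases)
    case (2 b) show ?case by (cases b) (simp_all add: tensor_basis C5_counit_basis)
  qed (simp add: lin_iff)
next
  case (5 c)
  show ?case
  proof (rule lin_eqI[where G = "\<lambda>c. c", OF lin_compose[OF lin_tensor_lift lin_C5_comult]],
      goal_cases)
    case (2 b) show ?case by (cases b) (simp_all add: tensor_basis C5_counit_basis)
  qed (simp add: lin_iff)
qed

lemma bilin_C5_rack: "bilin C5_rack"
  unfolding bilin_def C5_rack_def
  by (intro conjI allI lin_compose[OF lin_lin_ext] lin_tensor_left lin_tensor_right)

lemma lin_C5_rack: "lin (C5_rack v)" and lin_C5_rack_left: "lin (\<lambda>v. C5_rack v w)"
  using bilin_C5_rack by (auto simp: bilin_def)

lemmas C5_rack_linear [simp] =
  lin_add[OF lin_C5_rack] lin_scale[OF lin_C5_rack] lin_zero[OF lin_C5_rack]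
  lin_add[OF lin_C5_rack_left] lin_scale[OF lin_C5_rack_left] lin_zero[OF lin_C5_rack_left]

lemma C5_rack_basis_simp [simp]: "C5_rack (basis a) (basis b) = C5_rack_basis a b"
  by (simp add: C5_rack_def tensor_basis)

lemma C5_counit_rack: "C5_counit (C5_rack a b) = C5_counit a * C5_counit b"
proof -
  \<comment> \<open>\<open>lin_eqI\<close> compares vector-valued maps, so the scalars are put on
    the line of \<open>basis e1\<close> and read off again as coefficients.\<close>
  have "scale (C5_counit (C5_rack a b)) (basis e1) =
      scale (C5_counit a * C5_counit b) (basis e1)"
  proof (rule lin_eqI[where F = "\<lambda>a. scale (C5_counit (C5_rack a b)) (basis e1)"
        and G = "\<lambda>a. scale (C5_counit a * C5_counit b) (basis e1)"], goal_cases)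
    case (3 a)
    show ?case
    proof (rule lin_eqI[where F = "\<lambda>b. scale (C5_counit (C5_rack (basis a) b)) (basis e1)"
          and G = "\<lambda>b. scale (C5_counit (basis a) * C5_counit b) (basis e1)"], goal_cases)
      case (3 b)
      show ?case
        by (cases a; cases b) (simp_all add: C5_counit_basis, simp_all add: C5_counit_def)
    qed (simp_all add: lin_iff scale_add_left algebra_simps)
  qed (simp_all add: lin_iff scale_add_left algebra_simps)
  from arg_cong[OF this, of "\<lambda>v. Poly_Mapping.lookup v e1"] show ?thesis
    by (simp add: basis_def)
qed

text \<open>The product of two basis vectors other than \<open>1\<close> is \<open>0\<close> or
  \<open>t\<close>, and \<open>t\<close> is killed by all of these and acts as zero. So only terms
  with a factor \<open>1\<close> can contribute.\<close>

lemma C5_rack_self_distrib: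
  "C5_rack (C5_rack a b) c =
     tensor_lift (\<lambda>c1 c2. C5_rack (C5_rack a c1) (C5_rack b c2)) (C5_comult c)"
proof (rule lin_eqI[where F = "\<lambda>a. C5_rack (C5_rack a b) c" and G = "\<lambda>a.
      tensor_lift (\<lambda>c1 c2. C5_rack (C5_rack a c1) (C5_rack b c2)) (C5_comult c)"], goal_cases)
  case (3 a)
  show ?case
  proof (rule lin_eqI[where F = "\<lambda>b. C5_rack (C5_rack (basis a) b) c" and G = "\<lambda>b.
      tensor_lift (\<lambda>c1 c2. C5_rack (C5_rack (basis a) c1) (C5_rack b c2)) (C5_comult c)"],
      goal_cases)
    case (3 b)
    show ?case
    proof (rule lin_eqI[OF lin_C5_rack lin_compose[OF lin_tensor_lift lin_C5_comult]], goal_cases)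
      case (1 c)
      show ?case by (cases a; cases b; cases c) (simp_all add: tensor_basis)
    qed
  next
    case 1 show ?case by (simp add: lin_iff)
  next
    case 2 show ?case by (rule tensor_lift_param) (simp add: lin_iff)
  qed
next
  case 1 show ?case by (simp add: lin_iff)
next
  case 2 show ?case by (rule tensor_lift_param) (simp add: lin_iff)
qed

lemma C5_rack_coalgebra_hom:
  "coalgebra_hom (tensor_comult C5_comult C5_comult) (tensor_counit C5_counit C5_counit)
     C5_comult C5_counit (tensor_lift C5_rack)"
  unfolding coalgebra_hom_def
proof (intro conjI allI, goal_cases)
  case 1 show ?case by (rule lin_tensor_lift)
next
  case (2 u)
  show ?case
    unfolding tensor_comult_def
  proof (rule lin_eqI[OF lin_compose[OF lin_C5_comult lin_tensor_lift]
        lin_compose[OF lin_tensor_lift lin_tensor_lift]], goal_cases)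
    case (1 p)
    show ?case
      by (cases p; cases "fst p"; cases "snd p")
        (simp_all add: tensor_basis lin_zero[OF lin_C5_comult] add_ac)
  qed
next
  case (3 u)
  show ?case
    \<comment> \<open>Only the outer counit is unfolded, to match the coefficient in
      \<open>tensor_counit_lin\<close>.\<close>
    unfolding C5_counit_def[of "tensor_lift _ _"]
    by (rule tensor_counit_lin[OF lin_tensor_lift])
      (simp add: C5_counit_rack flip: C5_counit_def C5_rack_basis_simp)
qed

lemma C5_rack_bialgebra:
  "rack_bialgebra (C5_comult :: 'k::field C5 \<Rightarrow> _) C5_counit (basis e1) C5_rack"
proof (intro rack_bialgebra.intro rack_bialgebra_axioms.intro C5_coalgebra C5_rack_coalgebra_hom
    bilin_C5_rack C5_rack_self_distrib C5_counit_rack, goal_cases)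
  case 1 show ?case by (simp add: group_like_def C5_counit_basis)
next
  case (2 a)
  show ?case
    by (rule lin_eqI[where F = "\<lambda>a. C5_rack a (basis e1)" and G = "\<lambda>a. a"])
      (simp_all add: lin_iff)
next
  case (3 a)
  show ?case
  proof (rule lin_eqI[OF lin_C5_rack, where G = "\<lambda>a. scale (C5_counit a) (basis e1)"], goal_cases)
    case (2 b) show ?case by (cases b) (simp_all add: C5_counit_basis)
  qed (simp add: lin_iff scale_add_left)
qed


section \<open>The action\<close>

definition N :: "'k::field C5 \<Rightarrow> 'k C5" where
  "N v = C5_rack v (basis ey)"

text \<open>The indeterminate \<open>X\<close>, which acts as \<open>0 = N\<^sup>2\<close>, has weight 2.\<close>

definition weight :: "(indet \<Rightarrow>\<^sub>0 nat) \<Rightarrow> nat" where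
  "weight m = 2 * Poly_Mapping.lookup m iX + Poly_Mapping.lookup m iY + Poly_Mapping.lookup m iZ"

text \<open>A monomial acts by a power of the single operator \<open>N\<close>, so the module law
  reduces to additivity of \<open>weight\<close>.\<close>

definition C5_act :: "'k::field C5 \<Rightarrow> 'k pXYZ \<Rightarrow> 'k C5" where
  "C5_act a = lin_ext (\<lambda>m. (N ^^ weight m) a)"

lemma N_linear [simp]: "N (v + w) = N v + N w" "N (scale c v) = scale c (N v)" "N 0 = 0"
  by (simp_all add: N_def)

lemma N_basis: "N (basis b) = (if b = ex then basis et else 0)"
  by (cases b) (simp_all add: N_def)

lemma lin_N_funpow: "lin (N ^^ n)"
  by (induction n) (auto simp: lin_iff)

lemma N_funpow_kernel: "N v = 0 \<Longrightarrow> (N ^^ n) v = (if n = 0 then v else 0)"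
  by (cases n) (auto simp: funpow_Suc_right lin_zero[OF lin_N_funpow] simp del: funpow.simps)

lemma N_funpow_ex:
  "(N ^^ n) (basis ex) = (if n = 0 then basis ex else if n = 1 then basis et else 0)"
  by (cases n) (simp_all add: funpow_Suc_right N_basis N_funpow_kernel del: funpow.simps(2))

lemma weight_add: "weight (m + n) = weight m + weight n"
  by (simp add: weight_def lookup_add)

text \<open>All indeterminates have positive weight, so weight \<open>0\<close> singles out the
  monomial on which the counit is \<open>1\<close>.\<close>

lemma weight_eq_0_iff: "weight m = 0 \<longleftrightarrow> m = 0"
proof
  assume "weight m = 0"
  then have "Poly_Mapping.lookup m i = Poly_Mapping.lookup 0 i" for i
    by (cases i) (simp_all add: weight_def)
  then show "m = 0" by (rule poly_mapping_eqI)
qed (simp add: weight_def)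

lemma C5_act_basis [simp]: "C5_act a (basis m) = (N ^^ weight m) a"
  by (simp add: C5_act_def)

lemma C5_act_gen: "C5_act a (gen i) = (N ^^ (if i = iX then 2 else 1)) a"
  by (cases i) (simp_all add: gen_def weight_def lookup_single)

lemma lin_C5_act: "lin (C5_act a)"
  by (simp add: C5_act_def lin_lin_ext)

lemma lin_C5_act_left: "lin (\<lambda>a. C5_act a h)"
  unfolding C5_act_def by (rule lin_ext_param) (rule lin_N_funpow)

lemma bilin_C5_act: "bilin C5_act"
  by (simp add: bilin_def lin_C5_act lin_C5_act_left)

lemma C5_act_mult: "C5_act c (g * h) = C5_act (C5_act c g) h"
proof (rule lin_eqI[where F = "\<lambda>g. C5_act c (g * h)" and G = "\<lambda>g. C5_act (C5_act c g) h"],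
    goal_cases)
  case 1
  show ?case using lin_C5_act[of c] by (simp add: lin_iff algebra_simps)
next
  case 2
  show ?case by (rule lin_compose[OF lin_C5_act_left lin_C5_act])
next
  case (3 m)
  show ?case
  proof (rule lin_eqI[where F = "\<lambda>h. C5_act c (basis m * h)", OF _ lin_C5_act], goal_cases)
    case 1 show ?case using lin_C5_act[of c] by (simp add: lin_iff algebra_simps)
  next
    case (2 n)
    \<comment> \<open>The power belonging to \<open>m\<close> is applied first, hence the summands
      are swapped before \<open>funpow_add\<close>.\<close>
    show ?case
      by (simp add: basis_times weight_add add.commute[of "weight m"] funpow_add)
  qed
qed

lemma C5_act_one: "C5_act c 1 = c"
  by (simp add: one_basis weight_def)

lemma C5_act_counit:
  assumes "N a = 0"
  shows "C5_act a (basis m) = scale (pXYZ_counit (basis m)) a"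
  using assms by (simp add: N_funpow_kernel weight_eq_0_iff pXYZ_counit_basis)

text \<open>On \<open>b\<close> the factor \<open>h2\<close> acts through the counit; the scalar
  moves onto \<open>h1\<close>, and the right counit law of \<open>H\<close> collapses the
  sum.\<close>

lemma C5_act_comult_left:
  assumes "N b = 0"
  shows "tensor_lift (\<lambda>h1 h2. C5_act a h1 \<otimes> C5_act b h2) (pXYZ_comult h) = C5_act a h \<otimes> b"
proof -
  have "tensor_lift (\<lambda>h1 h2. C5_act a h1 \<otimes> C5_act b h2) (pXYZ_comult h) =
      tensor_lift (\<lambda>h1 h2. C5_act a (scale (pXYZ_counit h2) h1) \<otimes> b) (pXYZ_comult h)"
    by (rule fun_cong[OF tensor_lift_cong])
      (simp add: C5_act_counit[OF assms] lin_scale[OF lin_C5_act] del: C5_act_basis)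
  also have "\<dots> =
      C5_act a (tensor_lift (\<lambda>h1 h2. scale (pXYZ_counit h2) h1) (pXYZ_comult h)) \<otimes> b"
    by (rule lin_tensor_lift_compose[OF lin_compose[OF lin_tensor_left lin_C5_act], symmetric])
  finally show ?thesis by (simp only: pXYZ_counit_right)
qed

lemma C5_act_comult_right:
  assumes "N a = 0"
  shows "tensor_lift (\<lambda>h1 h2. C5_act a h1 \<otimes> C5_act b h2) (pXYZ_comult h) = a \<otimes> C5_act b h"
proof -
  have "tensor_lift (\<lambda>h1 h2. C5_act a h1 \<otimes> C5_act b h2) (pXYZ_comult h) =
      tensor_lift (\<lambda>h1 h2. a \<otimes> C5_act b (scale (pXYZ_counit h1) h2)) (pXYZ_comult h)"
    by (rule fun_cong[OF tensor_lift_cong])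
      (simp add: C5_act_counit[OF assms] lin_scale[OF lin_C5_act] del: C5_act_basis)
  also have "\<dots> =
      a \<otimes> C5_act b (tensor_lift (\<lambda>h1 h2. scale (pXYZ_counit h1) h2) (pXYZ_comult h))"
    by (rule lin_tensor_lift_compose[OF lin_compose[OF lin_tensor_right lin_C5_act], symmetric])
  finally show ?thesis by (simp only: pXYZ_counit_left)
qed

lemma C5_act_coalgebra_hom:
  "coalgebra_hom (tensor_comult C5_comult pXYZ_comult) (tensor_counit C5_counit pXYZ_counit)
     C5_comult C5_counit (tensor_lift (C5_act :: 'k::field C5 \<Rightarrow> _))"
  unfolding coalgebra_hom_def
proof (intro conjI allI, goal_cases)
  case 1 show ?case by (rule lin_tensor_lift)
next
  case (2 u)
  show ?case
    unfolding tensor_comult_def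
  proof (rule lin_eqI[OF lin_compose[OF lin_C5_comult lin_tensor_lift]
        lin_compose[OF lin_tensor_lift lin_tensor_lift]], goal_cases)
    case (1 p)
    obtain a m where p: "p = (a, m)" by (cases p)
    have "tensor_lift (\<lambda>c1 c2. tensor_lift C5_act c1 \<otimes> tensor_lift C5_act c2)
        ((a1 \<otimes> b1) \<otimes> (a2 \<otimes> b2)) = C5_act a1 b1 \<otimes> C5_act a2 b2"
      for a1 a2 :: "'k C5" and b1 b2
      by (subst tensor_lift_tensor)
        (auto simp: bilin_def lin_iff tensor_lift_tensor[OF bilin_C5_act])
    then show ?case
      unfolding p
      \<comment> \<open>At \<open>x\<close> the right side is
        \<open>1 \<otimes> x.m + x.m \<otimes> 1\<close> plus \<open>y \<otimes> z\<close> when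
        \<open>m\<close> has weight 0. Weight 0 gives the coproduct of \<open>x\<close>, weight 1
        that of \<open>t\<close>, higher weight 0.\<close>
      by (cases a)
        (simp_all add: tensor_basis lin_tensor_lift_compose[OF lin_tensor_lift]
          C5_act_comult_left C5_act_comult_right N_basis N_funpow_ex N_funpow_kernel
          lin_zero[OF lin_C5_comult])
  qed
next
  case (3 u)
  show ?case
    unfolding C5_counit_def[of "tensor_lift _ _"]
  proof (rule tensor_counit_lin[OF lin_tensor_lift])
    fix a m
    show "Poly_Mapping.lookup (tensor_lift C5_act (basis (a, m))) e1 =
        C5_counit (basis a) * pXYZ_counit (basis m)"
      by (cases a)
        (auto simp: N_funpow_kernel N_funpow_ex N_basis weight_eq_0_iff pXYZ_counit_basis
          C5_counit_basis simp flip: C5_counit_def, auto simp: C5_counit_def)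
  qed
qed

section \<open>The map \<open>q\<close> and its compatibility with the action\<close>

lemma lin_C5_q: "lin C5_q"
  by (simp add: C5_q_def lin_lin_ext)

lemma C5_q_basis_simp [simp]: "C5_q (basis b) = C5_q_basis b"
  by (simp add: C5_q_def)

lemma C5_q_coalgebra_hom: "coalgebra_hom C5_comult C5_counit pXYZ_comult pXYZ_counit C5_q"
  unfolding coalgebra_hom_def
proof (intro conjI allI, goal_cases)
  case 1 show ?case by (rule lin_C5_q)
next
  case (2 c)
  show ?case
  proof (rule lin_eqI[OF lin_compose[OF alg_hom_lin[OF alg_hom_comult] lin_C5_q]
        lin_compose[OF lin_tensor_lift lin_C5_comult]], goal_cases)
    case (1 b)
    show ?case
      by (cases b) (simp_all add: tensor_basis pXYZ_comult_gen alg_hom_one[OF alg_hom_comult]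
          alg_hom_one[OF alg_hom_tensor_one] lin_zero[OF alg_hom_lin[OF alg_hom_comult]])
  qed
next
  case (3 c)
  have "scale (pXYZ_counit (C5_q c)) (basis e1) = scale (C5_counit c) (basis e1)"
  proof (rule lin_eqI[where F = "\<lambda>c. scale (pXYZ_counit (C5_q c)) (basis e1)"
        and G = "\<lambda>c. scale (C5_counit c) (basis e1)"], goal_cases)
    case 1
    show ?case
      by (simp add: lin_iff pXYZ_counit_def lookup_add scale_add_left
          lin_add[OF lin_C5_q] lin_scale[OF lin_C5_q])
  next
    case (3 b)
    show ?case
      by (cases b) (simp_all add: pXYZ_counit_gen C5_counit_basis, simp_all add: pXYZ_counit_def)
  qed (simp add: lin_iff scale_add_left)
  from arg_cong[OF this, of "\<lambda>v. Poly_Mapping.lookup v e1"] show ?case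
    by (simp add: basis_def)
qed

text \<open>\<open>N\<close> is defined from \<open>y\<close> but serves \<open>z\<close> too, as
  both act alike; \<open>x\<close> and \<open>t\<close> act as zero on both sides, by
  \<open>N^2 = 0\<close> and \<open>q t = 0\<close>.\<close>

lemma C5_rack_eq_act: "C5_rack a b = C5_act a (C5_q b)"
proof (rule lin_eqI[OF lin_C5_rack lin_compose[OF lin_C5_act lin_C5_q]])
  fix b
  show "C5_rack a (basis b) = C5_act a (C5_q (basis b))"
  proof (rule lin_eqI[OF lin_C5_rack_left lin_C5_act_left])
    fix a
    show "C5_rack (basis a) (basis b) = C5_act (basis a) (C5_q (basis b))"
      by (cases b; cases a)
        (simp_all add: C5_act_one C5_act_gen N_basis numeral_2_eq_2 lin_zero[OF lin_C5_act])
  qed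
qed

text \<open>\<open>N\<close> maps into the line of \<open>t\<close>, which \<open>C5_q\<close>
  kills, so only the zeroth power survives.\<close>

lemma C5_q_act: "C5_q (C5_act a (basis m)) = scale (pXYZ_counit (basis m)) (C5_q a)"
proof (rule lin_eqI[OF lin_compose[OF lin_C5_q lin_C5_act_left]])
  show "lin (\<lambda>a. scale (pXYZ_counit (basis m)) (C5_q a))"
    by (simp add: lin_iff mult.commute lin_add[OF lin_C5_q] lin_scale[OF lin_C5_q])
  show "C5_q (C5_act (basis a) (basis m)) = scale (pXYZ_counit (basis m)) (C5_q (basis a))" for a
    by (cases a) (auto simp: N_funpow_kernel N_funpow_ex N_basis weight_eq_0_iff pXYZ_counit_basis
        lin_zero[OF lin_C5_q])
qed

lemma C5_yetter_drinfeld: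
  "tensor_lift (\<lambda>h1 h2. h1 * C5_q (C5_act a h2)) (pXYZ_comult h) = C5_q a * h"
proof -
  have "tensor_lift (\<lambda>h1 h2. h1 * C5_q (C5_act a h2)) (pXYZ_comult h) =
      tensor_lift (\<lambda>h1 h2. C5_q a * scale (pXYZ_counit h2) h1) (pXYZ_comult h)"
    by (rule fun_cong[OF tensor_lift_cong]) (simp add: C5_q_act mult.commute del: C5_act_basis)
  \<comment> \<open>Commutativity has brought \<open>C5_q a\<close> to the front, so it leaves the
    sum by linearity.\<close>
  also have "\<dots> =
      C5_q a * tensor_lift (\<lambda>h1 h2. scale (pXYZ_counit h2) h1) (pXYZ_comult h)"
    using bilin_times by (intro lin_tensor_lift_compose[symmetric]) (auto simp: bilin_def)
  finally show ?thesis by (simp only: pXYZ_counit_right)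
qed

theorem proposition5:
  "hopf_algebra (*) 1 (pXYZ_comult :: 'k::field pXYZ \<Rightarrow> _) pXYZ_counit \<and>
   (\<exists>act :: 'k C5 \<Rightarrow> 'k pXYZ \<Rightarrow> 'k C5.
      yetter_drinfeld_rack (*) 1 pXYZ_comult pXYZ_counit
        C5_comult C5_counit (basis e1) C5_rack act C5_q)"
proof (intro conjI exI[of _ C5_act] pXYZ_hopf_algebra)
  \<comment> \<open>The interpretations supply the bialgebra and rack bialgebra axioms;
    \<open>unfold_locales\<close> leaves only those of the action and of \<open>q\<close>.\<close>
  interpret hopf_algebra "(*)" 1 "pXYZ_comult :: 'k pXYZ \<Rightarrow> _" pXYZ_counit
    by (rule pXYZ_hopf_algebra)
  interpret rack_bialgebra "C5_comult :: 'k C5 \<Rightarrow> _" C5_counit "basis e1" C5_rack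
    by (rule C5_rack_bialgebra)
  show "yetter_drinfeld_rack (*) 1 pXYZ_comult pXYZ_counit
      C5_comult C5_counit (basis e1) C5_rack C5_act (C5_q :: 'k C5 \<Rightarrow> _)"
    by unfold_locales
      (simp_all add: bilin_C5_act C5_act_mult C5_act_one C5_act_coalgebra_hom C5_q_coalgebra_hom
        C5_rack_eq_act[symmetric] C5_yetter_drinfeld del: C5_act_basis)
qed

end
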